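(* Let $w_1,w_2,w_3,w_4$ be the functions on $\Omega$ defined in the context, and let $\vec\varphi=(w_4,w_1,w_3,w_2)^T$. Then $\vec\varphi$ satisfies on $\Omega$ $$D^2\vec\varphi=f\,\vec\varphi,\qquad f=\sqrt{1-(D\vec\varphi)^T\gamma^5(D\vec\varphi)},$$ where the square root denotes a suitable continuous branch; that is, there is a continuous function $f:\Omega\to\mathbb C$ with $f^2=1-(D\vec\varphi)^T\gamma^5(D\vec\varphi)$ and $D^2\vec\varphi=f\vec\varphi$ on $\Omega$. Here $$D=\begin{pmatrix}0&0&0&\partial_\xi\\0&0&\partial_\eta&0\\0&-\partial_\xi&0&0\\-\partial_\eta&0&0&0\end{pmatrix},\qquad \gamma^5=\begin{pmatrix}0&0&1&0\\0&0&0&1\\1&0&0&0\\0&1&0&0\end{pmatrix}.$$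
   Context: The overbar does NOT denote complex conjugation; barred and unbarred quantities are independent. Fix $N\ge 1$ and complex constants $L_j,\bar L_j,\alpha_j,\bar\alpha_j,c_j,\bar c_j$ ($1\le j\le N$) with $L_j\ne0$, $\bar L_j\neq 0$ and $L_j\neq\bar L_k$ for all $j,k$. Put $\mathsf L=\mathrm{diag}(L_1,\dots,L_N)$, $\bar{\mathsf L}=\mathrm{diag}(\bar L_1,\dots,\bar L_N)$, columns $|\alpha\rangle=(\alpha_1,\dots,\alpha_N)^T$, $|\bar\alpha\rangle=(\bar\alpha_1,\dots,\bar\alpha_N)^T$, rows $\langle c|=(c_1,\dots,c_N)$, $\langle\bar c|=(\bar c_1,\dots,\bar c_N)$. For $(\xi,\eta)\in\mathbb C^2$ define the rows $$\langle a|=\langle c|\exp(\xi\mathsf L^{-1}-\eta\mathsf L),\qquad \langle\bar a|=\langle\bar c|\exp(-\xi\bar{\mathsf L}^{-1}+\eta\bar{\mathsf L}),$$ and the $N\times N$ matrices $$\mathsf A=\Big(\frac{\alpha_jc_k}{\bar L_j-L_k}\Big)_{j,k=1}^{N}\exp(\xi\mathsf L^{-1}-\eta\mathsf L),\qquad \bar{\mathsf A}=\Big(\frac{\bar\alpha_j\bar c_k}{L_j-\bar L_k}\Big)_{j,k=1}^{N}\exp(-\xi\bar{\mathsf L}^{-1}+\eta\bar{\mathsf L}),$$ which satisfy $\bar{\mathsf L}\mathsf A-\mathsf A\mathsf L=|\alpha\rangle\langle a|$ and $\mathsf L\bar{\mathsf A}-\bar{\mathsf A}\bar{\mathsf L}=|\bar\alpha\rangle\langle\bar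 a|$. Let $\Omega\subset\mathbb C^2$ be the open set where $\det(1+\mathsf A\bar{\mathsf A})\ne0$, and on $\Omega$ put $\mathsf G=(1+\mathsf A\bar{\mathsf A})^{-1}$, $\bar{\mathsf G}=(1+\bar{\mathsf A}\mathsf A)^{-1}$. Put $\langle b|=\langle a|\mathsf L^{-1}$, $\langle\bar b|=\langle\bar a|\bar{\mathsf L}^{-1}$, $|\beta\rangle=\bar{\mathsf L}^{-1}|\alpha\rangle$, $|\bar\beta\rangle=\mathsf L^{-1}|\bar\alpha\rangle$. Define the scalar functions on $\Omega$ $$w_1=\langle\bar a|\mathsf G|\alpha\rangle,\quad w_2=\langle a|\bar{\mathsf G}|\bar\alpha\rangle,\quad w_3=\langle\bar b|\mathsf G|\beta\rangle,\quad w_4=\langle b|\bar{\mathsf G}|\bar\beta\rangle.$$ $\partial_\xi,\partial_\eta$ are (holomorphic) partial derivatives, and $D$ (a Dirac-type operator) acts on 4-component columns. *)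

theory Defs
  imports "HOL-Analysis.Analysis"
begin

section \<open>Matrix preliminaries\<close>

text \<open>A row and a column of length \<open>N\<close> are both represented by \<open>complex ^ 'n\<close>; a row acts on
  matrices by \<open>v*\<close>, a column by \<open>*v\<close>, and row times column is \<open>scalar_product\<close>, which is bilinear
  (no conjugation).  The library's \<open>*\<close>, \<open>1\<close>, \<open>^\<close> on \<open>complex ^ 'n ^ 'n\<close> are componentwise, hence
  \<open>**\<close>, \<open>mat 1\<close> and the power below; \<open>mat z ** M\<close> is the multiple of \<open>M\<close> by the scalar \<open>z\<close>.\<close>

definition diag :: "complex ^ 'n \<Rightarrow> complex ^ 'n ^ 'n" where
  "diag d = (\<chi> j k. if j = k then d $ j else 0)"

primrec mat_pow :: "complex ^ 'n ^ 'n \<Rightarrow> nat \<Rightarrow> complex ^ 'n ^ 'n" where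
  "mat_pow M 0 = mat 1"
| "mat_pow M (Suc k) = M ** mat_pow M k"

definition mat_exp :: "complex ^ 'n ^ 'n \<Rightarrow> complex ^ 'n ^ 'n" where
  "mat_exp M = (\<Sum>k. (1 / fact k) *\<^sub>R mat_pow M k)"

lemma diag_mult_diag:
  fixes d e :: "complex ^ 'n"
  shows "diag d ** diag e = diag (\<chi> j. d $ j * e $ j)"
proof -
  have "(\<Sum>k\<in>UNIV. (if i = k then d $ i else 0) * (if k = j then e $ k else 0))
      = (if i = j then d $ i * e $ i else 0)" for i j :: 'n
  proof -
    have "(\<Sum>k\<in>UNIV. (if i = k then d $ i else 0) * (if k = j then e $ k else 0))
        = (\<Sum>k\<in>UNIV. if i = k then d $ i * (if i = j then e $ i else 0) else 0)"
      by (rule sum.cong) auto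
    then show ?thesis by simp
  qed
  then show ?thesis
    by (simp add: diag_def matrix_matrix_mult_def vec_eq_iff)
qed

lemma mat_pow_diag: "mat_pow (diag d) k = diag (\<chi> j. (d $ j) ^ k)"
proof (induction k)
  case 0
  show ?case by (simp add: diag_def mat_def vec_eq_iff)
next
  case (Suc k)
  then show ?case
    by (simp add: diag_mult_diag)
qed

lemma mat_exp_diag:
  fixes d :: "complex ^ 'n"
  shows "mat_exp (diag d) = diag (\<chi> j. exp (d $ j))"
proof -
  have "(\<lambda>k. (1 / fact k) *\<^sub>R mat_pow (diag d) k) sums diag (\<chi> j. exp (d $ j))"
    unfolding sums_def
  proof (rule vec_tendstoI, rule vec_tendstoI)
    fix i j :: 'n
    have "(\<lambda>m. \<Sum>k<m. (1 / fact k) *\<^sub>R (d $ i) ^ k) \<longlonglongrightarrow> exp (d $ i)"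
      using exp_converges[of "d $ i"] by (simp only: sums_def inverse_eq_divide)
    then show "(\<lambda>m. (\<Sum>k<m. (1 / fact k) *\<^sub>R mat_pow (diag d) k) $ i $ j)
        \<longlonglongrightarrow> diag (\<chi> j. exp (d $ j)) $ i $ j"
      unfolding mat_pow_diag by (cases "i = j") (simp_all add: diag_def)
  qed
  then show ?thesis
    unfolding mat_exp_def by (rule sums_unique[symmetric])
qed

lemma matrix_inv_diag:
  assumes "\<And>j. d $ j \<noteq> 0"
  shows "matrix_inv (diag d) = diag (\<chi> j. inverse (d $ j))"
proof -
  let ?E = "diag (\<chi> j. inverse (d $ j))"
  have r: "diag d ** ?E = mat 1" and l: "?E ** diag d = mat 1"
    unfolding diag_mult_diag using assms by (simp_all add: diag_def mat_def vec_eq_iff)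
  have inv: "matrix_inv (diag d) ** diag d = mat 1"
    unfolding matrix_inv_def by (rule someI2[of _ ?E], rule conjI[OF r l], erule conjunct2)
  have "matrix_inv (diag d) = matrix_inv (diag d) ** (diag d ** ?E)"
    unfolding r by (rule matrix_mul_rid[symmetric])
  also have "\<dots> = ?E"
    unfolding matrix_mul_assoc inv by (rule matrix_mul_lid)
  finally show ?thesis .
qed


section \<open>The functions \<open>w\<^sub>1, \<dots>, w\<^sub>4\<close>\<close>

text \<open>A letter with suffix \<open>b\<close> or \<open>bar\<close> is the barred quantity, independent of the unbarred one.
  Points \<open>(\<xi>, \<eta>)\<close> are elements of \<open>complex \<times> complex\<close>.\<close>

definition expL :: "complex ^ 'n \<Rightarrow> complex \<times> complex \<Rightarrow> complex ^ 'n ^ 'n" where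
  "expL L = (\<lambda>(\<xi>, \<eta>). mat_exp (mat \<xi> ** matrix_inv (diag L) - mat \<eta> ** diag L))"

definition expLbar :: "complex ^ 'n \<Rightarrow> complex \<times> complex \<Rightarrow> complex ^ 'n ^ 'n" where
  "expLbar Lb = (\<lambda>(\<xi>, \<eta>). mat_exp (- (mat \<xi> ** matrix_inv (diag Lb)) + mat \<eta> ** diag Lb))"

definition row_a :: "complex ^ 'n \<Rightarrow> complex ^ 'n \<Rightarrow> complex \<times> complex \<Rightarrow> complex ^ 'n" where
  "row_a L c p = c v* expL L p"

definition row_abar :: "complex ^ 'n \<Rightarrow> complex ^ 'n \<Rightarrow> complex \<times> complex \<Rightarrow> complex ^ 'n" where
  "row_abar Lb cb p = cb v* expLbar Lb p"

definition row_b :: "complex ^ 'n \<Rightarrow> complex ^ 'n \<Rightarrow> complex \<times> complex \<Rightarrow> complex ^ 'n" where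
  "row_b L c p = row_a L c p v* matrix_inv (diag L)"

definition row_bbar :: "complex ^ 'n \<Rightarrow> complex ^ 'n \<Rightarrow> complex \<times> complex \<Rightarrow> complex ^ 'n" where
  "row_bbar Lb cb p = row_abar Lb cb p v* matrix_inv (diag Lb)"

definition col_beta :: "complex ^ 'n \<Rightarrow> complex ^ 'n \<Rightarrow> complex ^ 'n" where
  "col_beta Lb \<alpha> = matrix_inv (diag Lb) *v \<alpha>"

definition col_betabar :: "complex ^ 'n \<Rightarrow> complex ^ 'n \<Rightarrow> complex ^ 'n" where
  "col_betabar L \<alpha>b = matrix_inv (diag L) *v \<alpha>b"

definition matA :: "complex ^ 'n \<Rightarrow> complex ^ 'n \<Rightarrow> complex ^ 'n \<Rightarrow> complex ^ 'n \<Rightarrow>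
    complex \<times> complex \<Rightarrow> complex ^ 'n ^ 'n" where
  "matA L Lb \<alpha> c p = (\<chi> j k. \<alpha> $ j * c $ k / (Lb $ j - L $ k)) ** expL L p"

definition matAbar :: "complex ^ 'n \<Rightarrow> complex ^ 'n \<Rightarrow> complex ^ 'n \<Rightarrow> complex ^ 'n \<Rightarrow>
    complex \<times> complex \<Rightarrow> complex ^ 'n ^ 'n" where
  "matAbar L Lb \<alpha>b cb p = (\<chi> j k. \<alpha>b $ j * cb $ k / (L $ j - Lb $ k)) ** expLbar Lb p"

definition Omega :: "complex ^ 'n \<Rightarrow> complex ^ 'n \<Rightarrow> complex ^ 'n \<Rightarrow> complex ^ 'n \<Rightarrow>
    complex ^ 'n \<Rightarrow> complex ^ 'n \<Rightarrow> (complex \<times> complex) set" where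
  "Omega L Lb \<alpha> \<alpha>b c cb =
    {p. det (mat 1 + matA L Lb \<alpha> c p ** matAbar L Lb \<alpha>b cb p) \<noteq> 0}"

text \<open>The functions from here on are meaningful only on \<open>Omega\<close>; elsewhere \<open>matrix_inv\<close> returns an
  unspecified matrix.\<close>

definition matG :: "complex ^ 'n \<Rightarrow> complex ^ 'n \<Rightarrow> complex ^ 'n \<Rightarrow> complex ^ 'n \<Rightarrow>
    complex ^ 'n \<Rightarrow> complex ^ 'n \<Rightarrow> complex \<times> complex \<Rightarrow> complex ^ 'n ^ 'n" where
  "matG L Lb \<alpha> \<alpha>b c cb p = matrix_inv (mat 1 + matA L Lb \<alpha> c p ** matAbar L Lb \<alpha>b cb p)"

definition matGbar :: "complex ^ 'n \<Rightarrow> complex ^ 'n \<Rightarrow> complex ^ 'n \<Rightarrow> complex ^ 'n \<Rightarrow>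
    complex ^ 'n \<Rightarrow> complex ^ 'n \<Rightarrow> complex \<times> complex \<Rightarrow> complex ^ 'n ^ 'n" where
  "matGbar L Lb \<alpha> \<alpha>b c cb p = matrix_inv (mat 1 + matAbar L Lb \<alpha>b cb p ** matA L Lb \<alpha> c p)"

definition w1 :: "complex ^ 'n \<Rightarrow> complex ^ 'n \<Rightarrow> complex ^ 'n \<Rightarrow> complex ^ 'n \<Rightarrow>
    complex ^ 'n \<Rightarrow> complex ^ 'n \<Rightarrow> complex \<times> complex \<Rightarrow> complex" where
  "w1 L Lb \<alpha> \<alpha>b c cb p = scalar_product (row_abar Lb cb p) (matG L Lb \<alpha> \<alpha>b c cb p *v \<alpha>)"

definition w2 :: "complex ^ 'n \<Rightarrow> complex ^ 'n \<Rightarrow> complex ^ 'n \<Rightarrow> complex ^ 'n \<Rightarrow>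
    complex ^ 'n \<Rightarrow> complex ^ 'n \<Rightarrow> complex \<times> complex \<Rightarrow> complex" where
  "w2 L Lb \<alpha> \<alpha>b c cb p = scalar_product (row_a L c p) (matGbar L Lb \<alpha> \<alpha>b c cb p *v \<alpha>b)"

definition w3 :: "complex ^ 'n \<Rightarrow> complex ^ 'n \<Rightarrow> complex ^ 'n \<Rightarrow> complex ^ 'n \<Rightarrow>
    complex ^ 'n \<Rightarrow> complex ^ 'n \<Rightarrow> complex \<times> complex \<Rightarrow> complex" where
  "w3 L Lb \<alpha> \<alpha>b c cb p =
    scalar_product (row_bbar Lb cb p) (matG L Lb \<alpha> \<alpha>b c cb p *v col_beta Lb \<alpha>)"

definition w4 :: "complex ^ 'n \<Rightarrow> complex ^ 'n \<Rightarrow> complex ^ 'n \<Rightarrow> complex ^ 'n \<Rightarrow>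
    complex ^ 'n \<Rightarrow> complex ^ 'n \<Rightarrow> complex \<times> complex \<Rightarrow> complex" where
  "w4 L Lb \<alpha> \<alpha>b c cb p =
    scalar_product (row_b L c p) (matGbar L Lb \<alpha> \<alpha>b c cb p *v col_betabar L \<alpha>b)"

definition phi_vec :: "complex ^ 'n \<Rightarrow> complex ^ 'n \<Rightarrow> complex ^ 'n \<Rightarrow> complex ^ 'n \<Rightarrow>
    complex ^ 'n \<Rightarrow> complex ^ 'n \<Rightarrow> complex \<times> complex \<Rightarrow> complex ^ 4" where
  "phi_vec L Lb \<alpha> \<alpha>b c cb p =
    vector [w4 L Lb \<alpha> \<alpha>b c cb p, w1 L Lb \<alpha> \<alpha>b c cb p, w3 L Lb \<alpha> \<alpha>b c cb p, w2 L Lb \<alpha> \<alpha>b c cb p]"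


section \<open>The Dirac-type operator\<close>

lemma vector_4 [simp]:
  "(vector [x, y, z, t] :: ('a::zero) ^ 4) $ 1 = x"
  "(vector [x, y, z, t] :: ('a::zero) ^ 4) $ 2 = y"
  "(vector [x, y, z, t] :: ('a::zero) ^ 4) $ 3 = z"
  "(vector [x, y, z, t] :: ('a::zero) ^ 4) $ 4 = t"
  unfolding vector_def by simp_all

definition d_xi :: "(complex \<times> complex \<Rightarrow> complex) \<Rightarrow> complex \<times> complex \<Rightarrow> complex" where
  "d_xi u = (\<lambda>(\<xi>, \<eta>). deriv (\<lambda>x. u (x, \<eta>)) \<xi>)"

definition d_eta :: "(complex \<times> complex \<Rightarrow> complex) \<Rightarrow> complex \<times> complex \<Rightarrow> complex" where
  "d_eta u = (\<lambda>(\<xi>, \<eta>). deriv (\<lambda>y. u (\<xi>, y)) \<eta>)"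

definition Dirac :: "(complex \<times> complex \<Rightarrow> complex ^ 4) \<Rightarrow> complex \<times> complex \<Rightarrow> complex ^ 4" where
  "Dirac \<Phi> p = vector
    [d_xi (\<lambda>q. \<Phi> q $ 4) p,
     d_eta (\<lambda>q. \<Phi> q $ 3) p,
     - d_xi (\<lambda>q. \<Phi> q $ 2) p,
     - d_eta (\<lambda>q. \<Phi> q $ 1) p]"

text \<open>\<open>deriv\<close> is total, so the existence of the partial derivatives that enter \<open>Dirac\<close> has to be
  stated separately.\<close>

definition Dirac_differentiable_on ::
    "(complex \<times> complex) set \<Rightarrow> (complex \<times> complex \<Rightarrow> complex ^ 4) \<Rightarrow> bool" where
  "Dirac_differentiable_on S \<Phi> \<longleftrightarrow> (\<forall>(\<xi>, \<eta>) \<in> S.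
    (\<lambda>x. \<Phi> (x, \<eta>) $ 4) field_differentiable at \<xi> \<and>
    (\<lambda>y. \<Phi> (\<xi>, y) $ 3) field_differentiable at \<eta> \<and>
    (\<lambda>x. \<Phi> (x, \<eta>) $ 2) field_differentiable at \<xi> \<and>
    (\<lambda>y. \<Phi> (\<xi>, y) $ 1) field_differentiable at \<eta>)"

definition gamma5 :: "complex ^ 4 ^ 4" where
  "gamma5 = vector
    [vector [0, 0, 1, 0],
     vector [0, 0, 0, 1],
     vector [1, 0, 0, 0],
     vector [0, 1, 0, 0]]"

end

theory Submission
  imports Defs
begin

text \<open>
  Differentiating the Sylvester relations shows that both partial derivatives of \<open>1 + A Ab\<close> have
  rank one: \<open>\<partial>\<^sub>\<xi> (1 + A Ab) = - (A \<beta>b) bb\<close> and \<open>\<partial>\<^sub>\<eta> (1 + A Ab) = - (A \<alpha>b) ab\<close>.  Hence the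
  derivatives of \<open>w\<^sub>1, \<dots>, w\<^sub>4\<close> factor into eight scalars \<open>p, pb, q, qb, r, rb, s, sb\<close>,
  for instance \<open>\<partial>\<^sub>\<xi> w\<^sub>1 = - pb s\<close>, and the mixed derivatives are \<open>- f w\<^sub>i\<close> with \<open>f = r s - p q\<close>.
  Commuting the diagonal matrices past \<open>G\<close> gives \<open>r s + p q = r s + pb qb = 1\<close> and
  \<open>sb p = qb r\<close>, and their barred versions, from which
  \<open>f\<^sup>2 = (r s + p q)\<^sup>2 - 4 r s p q = 1 - 2 (p sb pb s + q r qb rb)\<close>.
  Exchanging barred and unbarred data and reflecting \<open>(\<xi>, \<eta>)\<close> reduces \<open>w\<^sub>2, w\<^sub>4\<close> to \<open>w\<^sub>1, w\<^sub>3\<close>.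
\<close>

section \<open>Bilinear pairing of rows and columns\<close>

notation scalar_product (infixl "\<odot>" 70)

lemma scalar_product_linear:
  fixes u x y :: "'a::comm_ring_1 ^ 'n"
  shows "u \<odot> (x + y) = u \<odot> x + u \<odot> y" "u \<odot> (x - y) = u \<odot> x - u \<odot> y"
    "u \<odot> (k *s x) = k * (u \<odot> x)"
    "u \<odot> (- x) = - (u \<odot> x)" "u \<odot> 0 = 0"
  by (simp_all add: scalar_product_def algebra_simps sum.distrib sum_subtractf sum_negf sum_distrib_left)

lemma scalar_product_uminus_left:
  fixes u x :: "'a::comm_ring_1 ^ 'n"
  shows "(- u) \<odot> x = - (u \<odot> x)"
  by (simp add: scalar_product_def sum_negf)

lemma scalar_product_vector_matrix:
  fixes M :: "'a::comm_ring_1 ^ 'n ^ 'm"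
  shows "(u v* M) \<odot> x = u \<odot> (M *v x)"
proof -
  have "(\<Sum>j\<in>UNIV. (\<Sum>i\<in>UNIV. M $ i $ j * u $ i) * x $ j)
      = (\<Sum>j\<in>UNIV. \<Sum>i\<in>UNIV. u $ i * (M $ i $ j * x $ j))"
    unfolding sum_distrib_right by (intro sum.cong refl) (simp add: mult_ac)
  also have "\<dots> = (\<Sum>i\<in>UNIV. \<Sum>j\<in>UNIV. u $ i * (M $ i $ j * x $ j))"
    by (rule sum.swap)
  finally show ?thesis
    by (simp add: scalar_product_def vector_matrix_mult_def matrix_vector_mult_def
        sum_distrib_left mult_ac)
qed

section \<open>Algebra of a pair of Sylvester equations\<close>

text \<open>Each matrix identity is stated through its action on an arbitrary column, so that nested
  \<open>*v\<close> can be rewritten without reassociating products. \<open>L'\<close> and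
  \<open>Lb'\<close> are the inverses of \<open>L\<close> and \<open>Lb\<close>; \<open>G\<close>
  and \<open>Gb\<close> are those of \<open>1 + A Ab\<close> and \<open>1 + Ab A\<close>.\<close>

locale sylvester_pair =
  fixes L L' Lb Lb' A Ab G Gb :: "'a::field ^ 'n ^ 'n"
    and a ab b bb \<alpha> \<alpha>b \<beta> \<beta>b :: "'a ^ 'n"
  assumes LL': "L *v (L' *v x) = x" and L'L: "L' *v (L *v x) = x"
    and LbLb': "Lb *v (Lb' *v x) = x" and Lb'Lb: "Lb' *v (Lb *v x) = x"
    and sylv: "Lb *v (A *v x) = A *v (L *v x) + (a \<odot> x) *s \<alpha>"
    and sylvb: "L *v (Ab *v x) = Ab *v (Lb *v x) + (ab \<odot> x) *s \<alpha>b"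
    and GM: "G *v (x + A *v (Ab *v x)) = x" and MG: "G *v x + A *v (Ab *v (G *v x)) = x"
    and GMb: "Gb *v (x + Ab *v (A *v x)) = x" and MGb: "Gb *v x + Ab *v (A *v (Gb *v x)) = x"
    and b: "b = a v* L'" and bb: "bb = ab v* Lb'"
    and \<beta>: "\<beta> = Lb' *v \<alpha>" and \<beta>b: "\<beta>b = L' *v \<alpha>b"
begin

text \<open>The axioms are invariant under the exchange of barred and unbarred letters, so every
  identity below comes with a barred partner.\<close>

sublocale swap: sylvester_pair Lb Lb' L L' Ab A Gb G ab a bb b \<alpha>b \<alpha> \<beta>b \<beta>
  by unfold_locales (fact LL' L'L LbLb' Lb'Lb sylv sylvb GM MG GMb MGb b bb \<beta> \<beta>b)+

lemmas linear = matrix_vector_right_distrib matrix_vector_mult_diff_distrib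
  vector_scalar_commute scalar_product_linear

lemma b_app: "b \<odot> x = a \<odot> (L' *v x)"
  by (simp add: b scalar_product_vector_matrix)

text \<open>Multiply \<open>sylv\<close> by \<open>Lb'\<close> from the left and by
  \<open>L'\<close> from the right.\<close>

lemma sylv_inv: "A *v (L' *v x) = Lb' *v (A *v x) + (b \<odot> x) *s \<beta>"
proof -
  have "Lb' *v (Lb *v (A *v (L' *v x))) = Lb' *v (A *v x + (a \<odot> (L' *v x)) *s \<alpha>)"
    unfolding sylv LL' ..
  then show ?thesis
    by (simp add: Lb'Lb b_app \<beta> linear)
qed

end

section \<open>Commuting matrices past the resolvents \<open>G\<close> and \<open>Gb\<close>\<close>

text \<open>Facts become available under the prefix \<open>swap\<close> only when the context is reopened.\<close>

context sylvester_pair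
begin

text \<open>Push-through identity, from \<open>(1 + A Ab) A = A (1 + Ab A)\<close>.\<close>

lemma G_A: "G *v (A *v x) = A *v (Gb *v x)"
proof -
  have "A *v x = A *v (Gb *v x) + A *v (Ab *v (A *v (Gb *v x)))"
    by (metis MGb matrix_vector_right_distrib)
  then show ?thesis
    using GM by metis
qed

text \<open>By the two Sylvester relations the commutator of \<open>Lb\<close> with
  \<open>1 + A Ab\<close> is \<open>(A \<alpha>b) ab + \<alpha> (a Ab)\<close>, of rank at most two.
  Multiplying by \<open>G\<close> on both sides yields the two correction terms.\<close>

lemma Lb_G: "Lb *v (G *v x) =
    G *v (Lb *v x) - (ab \<odot> (G *v x)) *s (G *v (A *v \<alpha>b)) - (a \<odot> (Ab *v (G *v x))) *s (G *v \<alpha>)"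
proof -
  define y where "y = G *v x"
  have "Lb *v x = Lb *v y + Lb *v (A *v (Ab *v y))"
    by (metis MG y_def matrix_vector_right_distrib)
  also have "\<dots> = (Lb *v y + A *v (Ab *v (Lb *v y))) + (ab \<odot> y) *s (A *v \<alpha>b)
      + (a \<odot> (Ab *v y)) *s \<alpha>"
    by (simp add: sylv sylvb linear algebra_simps)
  finally have "G *v (Lb *v x) = Lb *v y + (ab \<odot> y) *s (G *v (A *v \<alpha>b))
      + (a \<odot> (Ab *v y)) *s (G *v \<alpha>)"
    by (simp only: GM matrix_vector_right_distrib[of G] vector_scalar_commute)
      (simp only: GM matrix_vector_right_distrib[symmetric])
  then show ?thesis
    by (simp add: y_def algebra_simps)
qed

text \<open>The computation of \<open>Lb_G\<close> with the inverted relations, in which the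
  rank-one terms have the opposite sign.\<close>

lemma Lb'_G: "Lb' *v (G *v x) =
    G *v (Lb' *v x) + (bb \<odot> (G *v x)) *s (G *v (A *v \<beta>b)) + (b \<odot> (Ab *v (G *v x))) *s (G *v \<beta>)"
proof -
  define y where "y = G *v x"
  have "Lb' *v x = Lb' *v y + Lb' *v (A *v (Ab *v y))"
    by (metis MG y_def matrix_vector_right_distrib)
  also have "Lb' *v (A *v (Ab *v y)) = A *v (L' *v (Ab *v y)) - (b \<odot> (Ab *v y)) *s \<beta>"
    by (simp add: sylv_inv)
  also have "L' *v (Ab *v y) = Ab *v (Lb' *v y) - (bb \<odot> y) *s \<beta>b"
    by (simp add: swap.sylv_inv)
  finally have *: "Lb' *v x = (Lb' *v y + A *v (Ab *v (Lb' *v y))) - (bb \<odot> y) *s (A *v \<beta>b)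
      - (b \<odot> (Ab *v y)) *s \<beta>"
    by (simp add: linear algebra_simps)
  have "G *v (Lb' *v x) = Lb' *v y - (bb \<odot> y) *s (G *v (A *v \<beta>b))
      - (b \<odot> (Ab *v y)) *s (G *v \<beta>)"
    unfolding * by (simp only: GM matrix_vector_mult_diff_distrib vector_scalar_commute)
  then show ?thesis
    by (simp add: y_def algebra_simps)
qed

end

section \<open>Scalar identities among the pairings\<close>

context sylvester_pair
begin

lemma Gb_eq: "Gb *v x = x - Ab *v (G *v (A *v x))"
  unfolding G_A using MGb[of x] by (simp add: algebra_simps)

text \<open>Serves the \<eta>-derivative of \<open>s\<close>. \<open>Lb\<close> passes
  \<open>G\<close> by \<open>Lb_G\<close> and \<open>A\<close> by \<open>sylv\<close>;
  \<open>Gb_eq\<close> then collects the coefficients of \<open>ab \<odot> (G *v \<alpha>)\<close>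
  into \<open>a \<odot> (Gb *v \<beta>b)\<close>.\<close>

lemma ab_Lb:
  "ab \<odot> (Lb *v (G *v (A *v \<beta>b))) =
    (ab \<odot> (G *v (A *v \<alpha>b))) * (1 - ab \<odot> (G *v (A *v \<beta>b))) + (ab \<odot> (G *v \<alpha>)) * (a \<odot> (Gb *v \<beta>b))"
  unfolding Lb_G sylv by (simp add: Gb_eq \<beta>b LL' linear algebra_simps)

text \<open>Counterpart of \<open>ab_Lb\<close> for the \<xi>-derivative of
  \<open>r\<close>.\<close>

lemma bb_Lb':
  "bb \<odot> (Lb' *v (G *v (A *v \<alpha>b))) =
    (bb \<odot> (G *v (A *v \<beta>b))) * (1 + bb \<odot> (G *v (A *v \<alpha>b))) - (bb \<odot> (G *v \<beta>)) * (b \<odot> (Gb *v \<alpha>b))"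
proof -
  have *: "Lb' *v (A *v \<alpha>b) = A *v \<beta>b - (b \<odot> \<alpha>b) *s \<beta>"
    by (simp add: sylv_inv \<beta>b)
  show ?thesis
    unfolding Lb'_G * by (simp add: Gb_eq linear algebra_simps)
qed

text \<open>This is \<open>r s + pb qb = 1\<close>. Writing \<open>ab\<close> as
  \<open>bb Lb\<close> and moving \<open>Lb\<close> to the right through \<open>G\<close> and
  \<open>A\<close> turns one pairing into an equation among all of them.\<close>

lemma det_relation:
  "(1 + bb \<odot> (G *v (A *v \<alpha>b))) * (1 - ab \<odot> (G *v (A *v \<beta>b)))
    + (bb \<odot> (G *v \<alpha>)) * (a \<odot> (Gb *v \<beta>b)) = 1"
proof -
  have "ab \<odot> (G *v (A *v \<beta>b)) = bb \<odot> (Lb *v (G *v (A *v \<beta>b)))"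
    by (simp add: swap.b_app Lb'Lb)
  also have "\<dots> = bb \<odot> (G *v (A *v \<alpha>b)) + (a \<odot> \<beta>b) * (bb \<odot> (G *v \<alpha>))
      - (ab \<odot> (G *v (A *v \<beta>b))) * (bb \<odot> (G *v (A *v \<alpha>b)))
      - (a \<odot> (Ab *v (G *v (A *v \<beta>b)))) * (bb \<odot> (G *v \<alpha>))"
    unfolding Lb_G sylv by (simp add: \<beta>b LL' linear algebra_simps)
  finally show ?thesis
    by (simp add: Gb_eq linear algebra_simps)
qed

text \<open>This is \<open>r s + p q = 1\<close>, by the same argument started from
  \<open>bb = ab Lb'\<close>.\<close>

lemma det_relation':
  "(1 + bb \<odot> (G *v (A *v \<alpha>b))) * (1 - ab \<odot> (G *v (A *v \<beta>b)))
    + (b \<odot> (Gb *v \<alpha>b)) * (ab \<odot> (G *v \<beta>)) = 1"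
proof -
  have *: "Lb' *v (A *v \<alpha>b) = A *v \<beta>b - (b \<odot> \<alpha>b) *s \<beta>"
    by (simp add: sylv_inv \<beta>b)
  have "bb \<odot> (G *v (A *v \<alpha>b)) = ab \<odot> (Lb' *v (G *v (A *v \<alpha>b)))"
    by (simp add: swap.b_app)
  also have "\<dots> = ab \<odot> (G *v (A *v \<beta>b)) - (b \<odot> \<alpha>b) * (ab \<odot> (G *v \<beta>))
      + (bb \<odot> (G *v (A *v \<alpha>b))) * (ab \<odot> (G *v (A *v \<beta>b)))
      + (b \<odot> (Ab *v (G *v (A *v \<alpha>b)))) * (ab \<odot> (G *v \<beta>))"
    unfolding Lb'_G * by (simp add: linear algebra_simps)
  finally show ?thesis
    by (simp add: Gb_eq linear algebra_simps)
qed

text \<open>This is \<open>sb p = qb r\<close>. Write \<open>b\<close> as \<open>a L'\<close> and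
  move \<open>L'\<close> past \<open>Gb\<close>, using
  \<open>L' \<alpha>b = \<beta>b\<close>.\<close>

lemma ratio_relation:
  "(1 - a \<odot> (Gb *v (Ab *v \<beta>))) * (b \<odot> (Gb *v \<alpha>b))
    = (a \<odot> (Gb *v \<beta>b)) * (1 + bb \<odot> (G *v (A *v \<alpha>b)))"
proof -
  have "b \<odot> (Gb *v \<alpha>b) = a \<odot> (L' *v (Gb *v \<alpha>b))"
    by (simp add: b_app)
  also have "\<dots> = a \<odot> (Gb *v \<beta>b) + (b \<odot> (Gb *v \<alpha>b)) * (a \<odot> (Gb *v (Ab *v \<beta>)))
      + (bb \<odot> (G *v (A *v \<alpha>b))) * (a \<odot> (Gb *v \<beta>b))"
    unfolding swap.Lb'_G G_A by (simp add: \<beta>b linear)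
  finally show ?thesis
    by (simp add: algebra_simps)
qed

end

section \<open>Derivatives of solutions of linear systems\<close>

lemma continuous_on_det:
  fixes M :: "'b::topological_space \<Rightarrow> 'a::real_normed_field ^ 'n ^ 'n"
  assumes "\<And>i j. continuous_on S (\<lambda>z. M z $ i $ j)"
  shows "continuous_on S (\<lambda>z. det (M z))"
  unfolding det_def by (intro continuous_intros assms)

lemma field_differentiable_prod:
  fixes f :: "'b \<Rightarrow> 'a::real_normed_field \<Rightarrow> 'a"
  assumes "\<And>i. i \<in> I \<Longrightarrow> f i field_differentiable at t"
  shows "(\<lambda>t. \<Prod>i\<in>I. f i t) field_differentiable at t"
proof -
  have "(f i has_field_derivative deriv (f i) t) (at t)" if "i \<in> I" for i
    using assms[OF that] by (simp add: DERIV_deriv_iff_field_differentiable)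
  then show ?thesis
    unfolding field_differentiable_def by - (rule exI, rule has_field_derivative_prod)
qed

lemma field_differentiable_det:
  fixes M :: "'a::real_normed_field \<Rightarrow> 'a ^ 'n ^ 'n"
  assumes "\<And>i j. (\<lambda>t. M t $ i $ j) field_differentiable at t"
  shows "(\<lambda>t. det (M t)) field_differentiable at t"
  unfolding det_def
  by (intro field_differentiable_sum field_differentiable_mult field_differentiable_const
      field_differentiable_prod assms)

lemma matrix_inv_vector:
  fixes M :: "'a::field ^ 'n ^ 'n"
  assumes "det M \<noteq> 0"
  shows "M *v (matrix_inv M *v x) = x" "matrix_inv M *v (M *v x) = x"
proof -
  have "invertible M"
    using assms by (simp add: invertible_det_nz)
  then have "M ** matrix_inv M = mat 1 \<and> matrix_inv M ** M = mat 1"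
    unfolding invertible_def matrix_inv_def by (rule someI_ex)
  then show "M *v (matrix_inv M *v x) = x" "matrix_inv M *v (M *v x) = x"
    by (simp_all add: matrix_vector_mul_assoc)
qed

text \<open>Quotients of determinants inherit continuity and differentiability from the entries of
  the system.\<close>

lemma matrix_inv_vector_cramer:
  fixes M :: "'a::field ^ 'n ^ 'n"
  assumes "det M \<noteq> 0"
  shows "(matrix_inv M *v x) $ k = det (\<chi> i j. if j = k then x $ i else M $ i $ j) / det M"
  using cramer[OF assms, of "matrix_inv M *v x" x] matrix_inv_vector(1)[OF assms, of x]
  by (simp add: vec_eq_iff)

lemma continuous_on_matrix_inv_vector:
  fixes M :: "'b::topological_space \<Rightarrow> 'a::real_normed_field ^ 'n ^ 'n"
  assumes M: "\<And>i j. continuous_on S (\<lambda>z. M z $ i $ j)"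
    and X: "\<And>i. continuous_on S (\<lambda>z. X z $ i)"
    and nz: "\<And>z. z \<in> S \<Longrightarrow> det (M z) \<noteq> 0"
  shows "continuous_on S (\<lambda>z. (matrix_inv (M z) *v X z) $ k)"
proof -
  have entry: "continuous_on S (\<lambda>z. (\<chi> i j. if j = k then X z $ i else M z $ i $ j) $ i $ j)" for i j
    by (cases "j = k") (simp_all add: M X)
  have "continuous_on S (\<lambda>z. det (\<chi> i j. if j = k then X z $ i else M z $ i $ j) / det (M z))"
    by (rule continuous_on_divide[OF continuous_on_det[OF entry] continuous_on_det[OF M]])
       (simp add: nz)
  then show ?thesis
    by (rule continuous_on_eq) (simp add: matrix_inv_vector_cramer nz)
qed

text \<open>Cramer's rule makes \<open>y = M\<^sup>-\<^sup>1 X\<close> differentiable; its derivative is then read off from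
  \<open>M y = X\<close>.\<close>

lemma has_field_derivative_matrix_inv_vector:
  fixes M :: "complex \<Rightarrow> complex ^ 'n ^ 'n"
  assumes dM: "\<And>i j. ((\<lambda>t. M t $ i $ j) has_field_derivative M' $ i $ j) (at t)"
    and dX: "\<And>i. ((\<lambda>t. X t $ i) has_field_derivative X' $ i) (at t)"
    and rank1: "\<And>y. M' *v y = - (u \<odot> y) *s v"
    and S: "open S" "t \<in> S" "\<And>x. x \<in> S \<Longrightarrow> det (M x) \<noteq> 0"
  shows "((\<lambda>t. (matrix_inv (M t) *v X t) $ k) has_field_derivative
     ((u \<odot> (matrix_inv (M t) *v X t)) *s (matrix_inv (M t) *v v) + matrix_inv (M t) *v X') $ k) (at t)"
proof -
  define y where "y x = matrix_inv (M x) *v X x" for x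
  have fM: "(\<lambda>t. M t $ i $ j) field_differentiable at t"
    and fX: "(\<lambda>t. X t $ i) field_differentiable at t" for i j
    using dM dX unfolding field_differentiable_def by blast+
  have y: "y x $ k = det (\<chi> i j. if j = k then X x $ i else M x $ i $ j) / det (M x)" if "x \<in> S" for x k
    unfolding y_def using S(3)[OF that] by (simp add: matrix_inv_vector_cramer)
  have "(\<lambda>x. y x $ k) field_differentiable at t" for k
  proof -
    have entry: "(\<lambda>x. (\<chi> i j. if j = k then X x $ i else M x $ i $ j) $ i $ j) field_differentiable at t"
      for i j
      by (cases "j = k") (simp_all add: fM fX)
    have "(\<lambda>x. det (\<chi> i j. if j = k then X x $ i else M x $ i $ j) / det (M x)) field_differentiable at t"
      by (rule field_differentiable_divide[OF field_differentiable_det[OF entry] field_differentiable_det[OF fM] S(3)[OF S(2)]])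
    then obtain d where "((\<lambda>x. det (\<chi> i j. if j = k then X x $ i else M x $ i $ j) / det (M x))
        has_field_derivative d) (at t)"
      unfolding field_differentiable_def ..
    then have "((\<lambda>x. y x $ k) has_field_derivative d) (at t)"
      by (rule has_field_derivative_transform_within_open[OF _ S(1,2)]) (simp add: y)
    then show ?thesis
      unfolding field_differentiable_def ..
  qed
  then have dy: "((\<lambda>x. y x $ k) has_field_derivative deriv (\<lambda>x. y x $ k) t) (at t)" for k
    by (simp add: DERIV_deriv_iff_field_differentiable)
  define y' where "y' = (\<chi> k. deriv (\<lambda>x. y x $ k) t)"
  have My: "M x *v y x = X x" if "x \<in> S" for x
    unfolding y_def by (rule matrix_inv_vector(1)[OF S(3)[OF that]])
  have "((\<lambda>x. (M x *v y x) $ i) has_field_derivative (M' *v y t + M t *v y') $ i) (at t)" for i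
  proof -
    have "((\<lambda>x. \<Sum>j\<in>UNIV. M x $ i $ j * y x $ j) has_field_derivative
        (\<Sum>j\<in>UNIV. M' $ i $ j * y t $ j + y' $ j * M t $ i $ j)) (at t)"
      unfolding y'_def vec_lambda_beta by (intro DERIV_sum DERIV_mult dM dy)
    then show ?thesis
      by (simp add: matrix_vector_mult_def sum.distrib mult.commute)
  qed
  then have "((\<lambda>x. X x $ i) has_field_derivative (M' *v y t + M t *v y') $ i) (at t)" for i
    by (rule has_field_derivative_transform_within_open[OF _ S(1,2)]) (simp add: My)
  then have "M' *v y t + M t *v y' = X'"
    unfolding vec_eq_iff by (blast intro: DERIV_unique dX)
  then have "M t *v y' = X' - M' *v y t"
    by (simp only: eq_diff_eq add.commute)
  then have "M t *v y' = (u \<odot> y t) *s v + X'"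
    by (simp only: rank1 vector_smult_lneg diff_minus_eq_add add.commute)
  then have "matrix_inv (M t) *v (M t *v y') = (u \<odot> y t) *s (matrix_inv (M t) *v v) + matrix_inv (M t) *v X'"
    by (simp add: matrix_vector_right_distrib vector_scalar_commute)
  then have "y' = (u \<odot> y t) *s (matrix_inv (M t) *v v) + matrix_inv (M t) *v X'"
    by (simp add: matrix_inv_vector(2)[OF S(3)[OF S(2)]])
  then show ?thesis
    using dy[of k] unfolding y_def[symmetric] by (simp add: y'_def vec_eq_iff)
qed

lemma has_field_derivative_scalar_product:
  assumes "\<And>i. ((\<lambda>t. R t $ i) has_field_derivative R' $ i) (at t)"
    and "\<And>i. ((\<lambda>t. X t $ i) has_field_derivative X' $ i) (at t)"
  shows "((\<lambda>t. R t \<odot> X t) has_field_derivative R' \<odot> X t + R t \<odot> X') (at t)"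
proof -
  have "((\<lambda>t. \<Sum>i\<in>UNIV. R t $ i * X t $ i) has_field_derivative
      (\<Sum>i\<in>UNIV. R' $ i * X t $ i + X' $ i * R t $ i)) (at t)"
    by (intro DERIV_sum DERIV_mult assms)
  then show ?thesis
    by (simp add: scalar_product_def sum.distrib mult.commute)
qed

text \<open>Since \<open>M' = - v u^T\<close>, the derivative of the inverse of \<open>M\<close> is
  \<open>M^-1 v u^T M^-1\<close>. Paired with a row and a column it splits into a product of two
  scalars, which is the source of all factorizations below.\<close>

lemma has_field_derivative_resolvent:
  fixes M :: "complex \<Rightarrow> complex ^ 'n ^ 'n"
  assumes dM: "\<And>i j. ((\<lambda>t. M t $ i $ j) has_field_derivative M' $ i $ j) (at t)"
    and dX: "\<And>i. ((\<lambda>t. X t $ i) has_field_derivative X' $ i) (at t)"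
    and dR: "\<And>i. ((\<lambda>t. R t $ i) has_field_derivative R' $ i) (at t)"
    and rank1: "\<And>y. M' *v y = - (u \<odot> y) *s v"
    and S: "open S" "t \<in> S" "\<And>x. x \<in> S \<Longrightarrow> det (M x) \<noteq> 0"
  shows "((\<lambda>t. R t \<odot> (matrix_inv (M t) *v X t)) has_field_derivative
     R' \<odot> (matrix_inv (M t) *v X t)
     + (u \<odot> (matrix_inv (M t) *v X t)) * (R t \<odot> (matrix_inv (M t) *v v))
     + R t \<odot> (matrix_inv (M t) *v X')) (at t)"
  using has_field_derivative_scalar_product[OF dR
      has_field_derivative_matrix_inv_vector[OF dM dX rank1 S]]
  by (simp add: scalar_product_linear add.assoc)

lemma has_field_derivative_mirror:
  fixes f :: "'a::real_normed_field \<Rightarrow> 'a"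
  assumes "(f has_field_derivative d) (at (- x))"
  shows "((\<lambda>x. f (- x)) has_field_derivative - d) (at x)"
  using DERIV_chain2[OF assms DERIV_minus[OF DERIV_ident]] by simp

section \<open>The Dirac equation\<close>

text \<open>If \<open>(1 + B A) x = 0\<close>, then
  \<open>(1 + A B) (A x) = A (1 + B A) x = 0\<close>, so \<open>A x = 0\<close> and hence
  \<open>x = 0\<close>.\<close>

lemma det_add_mult_commute:
  fixes A B :: "'a::field ^ 'n ^ 'n"
  assumes "det (mat 1 + A ** B) \<noteq> 0"
  shows "det (mat 1 + B ** A) \<noteq> 0"
proof -
  have "x = 0" if "(mat 1 + B ** A) *v x = 0" for x
  proof -
    have 0: "x + B *v (A *v x) = 0"
      using that by (simp add: matrix_vector_mult_add_rdistrib matrix_vector_mul_assoc)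
    have "(mat 1 + A ** B) *v (A *v x) = A *v (x + B *v (A *v x))"
      by (simp add: matrix_vector_mult_add_rdistrib matrix_vector_right_distrib
          matrix_vector_mul_assoc[symmetric])
    then have "A *v x = 0"
      using matrix_inv_vector(2)[OF assms, of "A *v x"] by (simp add: 0)
    then show ?thesis
      using 0 by simp
  qed
  then show ?thesis
    unfolding invertible_det_nz[symmetric] invertible_left_inverse matrix_left_invertible_ker by blast
qed

lemma matrix_vector_mult_uminus:
  fixes M :: "'a::comm_ring_1 ^ 'n ^ 'm"
  shows "(- M) *v x = - (M *v x)" "M *v (- x) = - (M *v x)"
  by (simp_all add: matrix_vector_mult_def vec_eq_iff sum_negf)

section \<open>Diagonal matrices and explicit entries\<close>

lemma diag_vector: "(diag d *v x) $ j = d $ j * x $ j"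
  by (simp add: diag_def matrix_vector_mult_def if_distrib[of "\<lambda>t. t * _"] cong: if_cong)

lemma vector_diag: "(x v* diag d) $ j = x $ j * d $ j"
  by (simp add: diag_def vector_matrix_mult_def if_distrib[of "\<lambda>t. _ * t"] cong: if_cong)

lemma matrix_diag: "(M ** diag d) $ i $ j = M $ i $ j * d $ j"
  by (simp add: diag_def matrix_matrix_mult_def if_distrib[of "\<lambda>t. _ * t"] cong: if_cong)

lemma mat_eq_diag: "mat k = diag (\<chi> j. k)"
  by (simp add: mat_def diag_def vec_eq_iff)

lemma diag_diff: "diag d - diag e = diag (d - e)"
  by (simp add: diag_def vec_eq_iff)

lemma expL_eq:
  assumes "\<And>j. L $ j \<noteq> 0"
  shows "expL L (\<xi>, \<eta>) = diag (\<chi> j. exp (\<xi> / L $ j - \<eta> * L $ j))"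
proof -
  have "mat \<xi> ** matrix_inv (diag L) - mat \<eta> ** diag L = diag (\<chi> j. \<xi> / L $ j - \<eta> * L $ j)"
    unfolding matrix_inv_diag[OF assms] mat_eq_diag diag_mult_diag diag_diff
    by (rule arg_cong[of _ _ diag]) (simp add: vec_eq_iff field_simps)
  then show ?thesis
    by (simp add: expL_def mat_exp_diag)
qed

text \<open>The barred exponential is the unbarred one at the reflected point. This is what makes
  the exchange of barred and unbarred data a symmetry.\<close>

lemma expLbar_eq: "expLbar L z = expL L (- z)"
proof (cases z)
  case (Pair \<xi> \<eta>)
  have m: "mat (- k) ** M = - (mat k ** M)" for k and M :: "complex ^ 'n ^ 'n"
    by (simp add: mat_def matrix_matrix_mult_def vec_eq_iff if_distrib[of "\<lambda>t. t * _"]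
        sum_negf[symmetric] cong: if_cong)
  show ?thesis
    by (simp add: Pair expLbar_def expL_def m)
qed

lemma row_abar_eq: "row_abar L c z = row_a L c (- z)"
  by (simp add: row_abar_def row_a_def expLbar_eq)

lemma row_bbar_eq: "row_bbar L c z = row_b L c (- z)"
  by (simp add: row_bbar_def row_b_def row_abar_eq)

lemma matAbar_eq: "matAbar L Lb \<alpha>b cb z = matA Lb L \<alpha>b cb (- z)"
  by (simp add: matAbar_def matA_def expLbar_eq)

lemma row_a_nth:
  assumes "\<And>j. L $ j \<noteq> 0"
  shows "row_a L c (\<xi>, \<eta>) $ j = c $ j * exp (\<xi> / L $ j - \<eta> * L $ j)"
  by (simp add: row_a_def expL_eq assms vector_diag)

lemma matA_nth:
  assumes "\<And>j. L $ j \<noteq> 0"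
  shows "matA L Lb \<alpha> c z $ j $ k = \<alpha> $ j * row_a L c z $ k / (Lb $ j - L $ k)"
  by (cases z) (simp add: matA_def expL_eq assms matrix_diag row_a_nth)

lemma row_a_derivs:
  assumes "\<And>j. L $ j \<noteq> 0"
  shows "((\<lambda>x. row_a L c (x, \<eta>) $ j) has_field_derivative row_a L c (\<xi>, \<eta>) $ j / L $ j) (at \<xi>)"
    and "((\<lambda>y. row_a L c (\<xi>, y) $ j) has_field_derivative - (row_a L c (\<xi>, \<eta>) $ j * L $ j)) (at \<eta>)"
  unfolding row_a_nth[OF assms] by (auto intro!: derivative_eq_intros simp: assms)

lemma row_abar_derivs:
  assumes "\<And>j. L $ j \<noteq> 0"
  shows "((\<lambda>x. row_abar L c (x, \<eta>) $ j) has_field_derivative - (row_abar L c (\<xi>, \<eta>) $ j / L $ j)) (at \<xi>)"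
    and "((\<lambda>y. row_abar L c (\<xi>, y) $ j) has_field_derivative row_abar L c (\<xi>, \<eta>) $ j * L $ j) (at \<eta>)"
  using has_field_derivative_mirror[OF row_a_derivs(1)[OF assms]]
    has_field_derivative_mirror[OF row_a_derivs(2)[OF assms]]
  by (simp_all add: row_abar_eq)

section \<open>The data, the eight scalars and the symmetry\<close>

locale dirac_data =
  fixes L Lb \<alpha> \<alpha>b c cb :: "complex ^ 'n"
  assumes L_nz: "L $ j \<noteq> 0" and Lb_nz: "Lb $ j \<noteq> 0" and L_neq: "L $ j \<noteq> Lb $ k"
begin

text \<open>Only the constants are exchanged here, not the point: a swapped quantity must be taken
  at \<open>- z\<close> to match its barred partner at \<open>z\<close>.\<close>

sublocale swap: dirac_data Lb L \<alpha>b \<alpha> cb c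
  by unfold_locales (fact L_nz Lb_nz L_neq[symmetric])+

abbreviation "\<Omega> \<equiv> Omega L Lb \<alpha> \<alpha>b c cb"
abbreviation "A \<equiv> matA L Lb \<alpha> c"
abbreviation "Ab \<equiv> matAbar L Lb \<alpha>b cb"
abbreviation "G \<equiv> matG L Lb \<alpha> \<alpha>b c cb"
abbreviation "Gb \<equiv> matGbar L Lb \<alpha> \<alpha>b c cb"
abbreviation "a \<equiv> row_a L c"
abbreviation "ab \<equiv> row_abar Lb cb"
abbreviation "b \<equiv> row_b L c"
abbreviation "bb \<equiv> row_bbar Lb cb"
abbreviation "\<beta> \<equiv> col_beta Lb \<alpha>"
abbreviation "\<beta>b \<equiv> col_betabar L \<alpha>b"

text \<open>The eight scalars into which the first derivatives factor. In \<open>r\<close>,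
  \<open>rb\<close>, \<open>s\<close>, \<open>sb\<close> the summand \<open>1\<close> stems from
  differentiating the row, the pairing from differentiating \<open>G\<close> or
  \<open>Gb\<close>.\<close>

definition "p z = b z \<odot> (Gb z *v \<alpha>b)"
definition "pb z = bb z \<odot> (G z *v \<alpha>)"
definition "q z = ab z \<odot> (G z *v \<beta>)"
definition "qb z = a z \<odot> (Gb z *v \<beta>b)"
definition "r z = 1 + bb z \<odot> (G z *v (A z *v \<alpha>b))"
definition "rb z = 1 + b z \<odot> (Gb z *v (Ab z *v \<alpha>))"
definition "s z = 1 - ab z \<odot> (G z *v (A z *v \<beta>b))"
definition "sb z = 1 - a z \<odot> (Gb z *v (Ab z *v \<beta>))"

lemma in_Omega: "z \<in> \<Omega> \<longleftrightarrow> det (mat 1 + A z ** Ab z) \<noteq> 0"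
  by (simp add: Omega_def)

lemma row_abar_neg: "row_abar L c (- z) = a z"
  and matAbar_neg: "matAbar Lb L \<alpha> c (- z) = A z"
  and matA_neg: "matA Lb L \<alpha>b cb (- z) = Ab z"
  and row_a_neg: "row_a Lb cb (- z) = ab z"
  and row_bbar_neg: "row_bbar L c (- z) = b z"
  and row_b_neg: "row_b Lb cb (- z) = bb z"
  and col_beta_swap: "col_beta L \<alpha>b = \<beta>b"
  and col_betabar_swap: "col_betabar Lb \<alpha> = \<beta>"
  by (simp_all add: row_abar_eq matAbar_eq row_bbar_eq col_beta_def col_betabar_def)

lemma matG_neg: "matG Lb L \<alpha>b \<alpha> cb c (- z) = Gb z"
  and matGbar_neg: "matGbar Lb L \<alpha>b \<alpha> cb c (- z) = G z"
  by (simp_all add: matG_def matGbar_def matAbar_neg matA_neg)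

lemmas neg_simps = row_abar_neg matAbar_neg matA_neg row_a_neg row_bbar_neg row_b_neg
  col_beta_swap col_betabar_swap matG_neg matGbar_neg

end

context dirac_data
begin

text \<open>For the swapped data at \<open>- z\<close> the matrix in question is
  \<open>1 + Ab A\<close>.\<close>

lemma uminus_in_Omega: "z \<in> \<Omega> \<Longrightarrow> - z \<in> Omega Lb L \<alpha>b \<alpha> cb c"
  by (simp add: in_Omega swap.in_Omega neg_simps det_add_mult_commute)

end

context dirac_data
begin

lemma w_swap:
  "w1 Lb L \<alpha>b \<alpha> cb c (- z) = w2 L Lb \<alpha> \<alpha>b c cb z"
  "w3 Lb L \<alpha>b \<alpha> cb c (- z) = w4 L Lb \<alpha> \<alpha>b c cb z"
  by (simp_all add: w1_def w2_def w3_def w4_def neg_simps)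

lemma swap_neg:
  "swap.p (- z) = pb z" "swap.pb (- z) = p z" "swap.q (- z) = qb z" "swap.qb (- z) = q z"
  "swap.r (- z) = rb z" "swap.rb (- z) = r z" "swap.s (- z) = sb z" "swap.sb (- z) = s z"
  by (simp_all add: p_def swap.p_def pb_def swap.pb_def q_def swap.q_def qb_def swap.qb_def
      r_def swap.r_def rb_def swap.rb_def s_def swap.s_def sb_def swap.sb_def neg_simps)

text \<open>\<open>A\<close> is of Cauchy type: the factor \<open>Lb $ j - L $ k\<close> cancels the
  denominator of the entry and leaves \<open>\<alpha> $ j * a z $ k\<close>.\<close>

lemma A_sylv: "diag Lb *v (A z *v x) = A z *v (diag L *v x) + (a z \<odot> x) *s \<alpha>"
proof -
  have "Lb $ j * (A z $ j $ k * x $ k) = A z $ j $ k * (L $ k * x $ k) + a z $ k * x $ k * \<alpha> $ j" for j k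
    using L_neq[of k j] by (simp add: matA_nth[OF L_nz] divide_simps) (simp add: algebra_simps)
  then show ?thesis
    unfolding vec_eq_iff
    by (simp add: diag_vector matrix_vector_mult_def[of "A z"] scalar_product_def sum_distrib_left
        sum_distrib_right sum.distrib)
qed

lemma diag_inv:
  "diag L *v (matrix_inv (diag L) *v x) = x" "matrix_inv (diag L) *v (diag L *v x) = x"
  by (simp_all add: matrix_inv_diag L_nz vec_eq_iff diag_vector)

lemma resolvent:
  assumes "z \<in> \<Omega>"
  shows "G z *v (x + A z *v (Ab z *v x)) = x" "G z *v x + A z *v (Ab z *v (G z *v x)) = x"
  using matrix_inv_vector[OF assms[unfolded in_Omega], of x]
  unfolding matG_def
  by (simp_all only: matrix_vector_mult_add_rdistrib matrix_vector_mul_assoc[symmetric]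
      matrix_vector_mul_lid)

section \<open>Continuity and openness of the domain\<close>

lemma continuous_on_row_a: "continuous_on S (\<lambda>z. a z $ j)"
proof -
  have "a z $ j = c $ j * exp (fst z / L $ j - snd z * L $ j)" for z
    by (cases z) (simp add: row_a_nth L_nz)
  then show ?thesis
    by (simp add: L_nz) (intro continuous_intros; simp add: L_nz)
qed

lemma continuous_on_row_abar: "continuous_on S (\<lambda>z. ab z $ j)"
proof -
  have "ab z $ j = cb $ j * exp (- fst z / Lb $ j + snd z * Lb $ j)" for z
    by (cases z) (simp add: row_abar_eq row_a_nth Lb_nz)
  then show ?thesis
    by (simp add: Lb_nz) (intro continuous_intros; simp add: Lb_nz)
qed

lemma Ab_nth: "Ab z $ j $ k = \<alpha>b $ j * ab z $ k / (L $ j - Lb $ k)"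
  unfolding matAbar_eq row_abar_eq by (rule matA_nth) (rule Lb_nz)

lemma continuous_on_matA: "continuous_on S (\<lambda>z. A z $ i $ j)"
  unfolding matA_nth[OF L_nz] using L_neq[of j i]
  by (intro continuous_intros continuous_on_row_a) auto

lemma continuous_on_matAbar: "continuous_on S (\<lambda>z. Ab z $ i $ j)"
  unfolding Ab_nth using L_neq[of i j]
  by (intro continuous_intros continuous_on_row_abar) auto

lemma continuous_on_system: "continuous_on S (\<lambda>z. (mat 1 + A z ** Ab z) $ i $ j)"
  unfolding vector_add_component matrix_matrix_mult_def vec_lambda_beta
  by (intro continuous_intros continuous_on_matA continuous_on_matAbar)

lemma open_Omega: "open \<Omega>"
  unfolding Omega_def
  by (intro open_Collect_neq continuous_on_det continuous_on_system continuous_on_const)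

text \<open>Supplies the one-variable neighbourhoods on which partial derivatives are taken.\<close>

lemma open_slices: "open {x. (x, \<eta>) \<in> \<Omega>}" "open {y. (\<xi>, y) \<in> \<Omega>}"
  using open_vimage[OF open_Omega, of "\<lambda>x. (x, \<eta>)"] open_vimage[OF open_Omega, of "Pair \<xi>"]
  by (simp_all add: vimage_def continuous_intros)

end

context dirac_data
begin

text \<open>The barred Sylvester relation and the inverse property of \<open>Gb\<close> are the
  unbarred facts for the swapped data at \<open>- z\<close>.\<close>

lemma sylvester:
  assumes "z \<in> \<Omega>"
  shows "sylvester_pair (diag L) (matrix_inv (diag L)) (diag Lb) (matrix_inv (diag Lb))
    (A z) (Ab z) (G z) (Gb z) (a z) (ab z) (b z) (bb z) \<alpha> \<alpha>b \<beta> \<beta>b"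
  using swap.A_sylv[of "- z"] swap.resolvent[OF uminus_in_Omega[OF assms]]
  by unfold_locales
    (simp_all only: neg_simps diag_inv swap.diag_inv A_sylv resolvent[OF assms]
      row_b_def row_bbar_def col_beta_def col_betabar_def)

lemma relations:
  assumes "z \<in> \<Omega>"
  shows "r z * s z + pb z * qb z = 1" "r z * s z + p z * q z = 1" "sb z * p z = qb z * r z"
proof -
  interpret sylvester_pair "diag L" "matrix_inv (diag L)" "diag Lb" "matrix_inv (diag Lb)"
    "A z" "Ab z" "G z" "Gb z" "a z" "ab z" "b z" "bb z" \<alpha> \<alpha>b \<beta> \<beta>b
    by (rule sylvester[OF assms])
  show "r z * s z + pb z * qb z = 1" "r z * s z + p z * q z = 1" "sb z * p z = qb z * r z"
    unfolding r_def s_def p_def pb_def q_def qb_def sb_def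
    by (rule det_relation det_relation' ratio_relation)+
qed

section \<open>Differentiation of the pairings\<close>

lemma matA_derivs:
  "((\<lambda>x. A (x, \<eta>) $ i $ j) has_field_derivative (A (\<xi>, \<eta>) ** matrix_inv (diag L)) $ i $ j) (at \<xi>)"
  "((\<lambda>y. A (\<xi>, y) $ i $ j) has_field_derivative (- (A (\<xi>, \<eta>) ** diag L)) $ i $ j) (at \<eta>)"
  unfolding matA_nth[OF L_nz] matrix_inv_diag[OF L_nz] matrix_diag vector_uminus_component
  by (auto intro!: derivative_eq_intros row_a_derivs L_nz simp: matA_nth[OF L_nz] L_neq[symmetric] divide_inverse)

lemma matAbar_derivs:
  "((\<lambda>x. Ab (x, \<eta>) $ i $ j) has_field_derivative (- (Ab (\<xi>, \<eta>) ** matrix_inv (diag Lb))) $ i $ j) (at \<xi>)"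
  "((\<lambda>y. Ab (\<xi>, y) $ i $ j) has_field_derivative (Ab (\<xi>, \<eta>) ** diag Lb) $ i $ j) (at \<eta>)"
  unfolding Ab_nth matrix_inv_diag[OF Lb_nz] matrix_diag vector_uminus_component
  by (auto intro!: derivative_eq_intros row_abar_derivs Lb_nz simp: Ab_nth L_neq divide_inverse)

lemma has_field_derivative_system:
  assumes "\<And>i j. ((\<lambda>t. X t $ i $ j) has_field_derivative X' $ i $ j) (at t)"
    and "\<And>i j. ((\<lambda>t. Y t $ i $ j) has_field_derivative Y' $ i $ j) (at t)"
  shows "((\<lambda>t. (mat 1 + X t ** Y t) $ i $ j) has_field_derivative (X' ** Y t + X t ** Y') $ i $ j) (at t)"
proof -
  have "((\<lambda>t. mat 1 $ i $ j + (\<Sum>k\<in>UNIV. X t $ i $ k * Y t $ k $ j)) has_field_derivative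
      0 + (\<Sum>k\<in>UNIV. X' $ i $ k * Y t $ k $ j + Y' $ k $ j * X t $ i $ k)) (at t)"
    by (intro DERIV_add DERIV_const DERIV_sum DERIV_mult assms)
  then show ?thesis
    by (simp add: matrix_matrix_mult_def sum.distrib mult.commute)
qed

text \<open>The \<xi>-derivative of \<open>1 + A Ab\<close> is \<open>A (L' Ab - Ab Lb')\<close>,
  where \<open>L'\<close> and \<open>Lb'\<close> are the inverse diagonal matrices. The inverted
  barred Sylvester relation reduces it to \<open>- (A \<beta>b) bb\<close>.\<close>

lemma xi_flow:
  assumes z: "(\<xi>, \<eta>) \<in> \<Omega>"
    and dX: "\<And>i. ((\<lambda>x. X (x, \<eta>) $ i) has_field_derivative X' $ i) (at \<xi>)"
    and dR: "\<And>i. ((\<lambda>x. R (x, \<eta>) $ i) has_field_derivative R' $ i) (at \<xi>)"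
  shows "((\<lambda>x. R (x, \<eta>) \<odot> (G (x, \<eta>) *v X (x, \<eta>))) has_field_derivative
    R' \<odot> (G (\<xi>, \<eta>) *v X (\<xi>, \<eta>))
    + (bb (\<xi>, \<eta>) \<odot> (G (\<xi>, \<eta>) *v X (\<xi>, \<eta>)))
        * (R (\<xi>, \<eta>) \<odot> (G (\<xi>, \<eta>) *v (A (\<xi>, \<eta>) *v \<beta>b)))
    + R (\<xi>, \<eta>) \<odot> (G (\<xi>, \<eta>) *v X')) (at \<xi>)"
proof -
  interpret sylvester_pair "diag L" "matrix_inv (diag L)" "diag Lb" "matrix_inv (diag Lb)"
    "A (\<xi>, \<eta>)" "Ab (\<xi>, \<eta>)" "G (\<xi>, \<eta>)" "Gb (\<xi>, \<eta>)" "a (\<xi>, \<eta>)" "ab (\<xi>, \<eta>)"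
    "b (\<xi>, \<eta>)" "bb (\<xi>, \<eta>)" \<alpha> \<alpha>b \<beta> \<beta>b
    by (rule sylvester[OF z])
  have rank1: "(A (\<xi>, \<eta>) ** matrix_inv (diag L) ** Ab (\<xi>, \<eta>)
      + A (\<xi>, \<eta>) ** - (Ab (\<xi>, \<eta>) ** matrix_inv (diag Lb))) *v y
      = - (bb (\<xi>, \<eta>) \<odot> y) *s (A (\<xi>, \<eta>) *v \<beta>b)" for y
  proof -
    have "(A (\<xi>, \<eta>) ** matrix_inv (diag L) ** Ab (\<xi>, \<eta>)
      + A (\<xi>, \<eta>) ** - (Ab (\<xi>, \<eta>) ** matrix_inv (diag Lb))) *v y
      = A (\<xi>, \<eta>) *v (matrix_inv (diag L) *v (Ab (\<xi>, \<eta>) *v y))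
       - A (\<xi>, \<eta>) *v (Ab (\<xi>, \<eta>) *v (matrix_inv (diag Lb) *v y))"
      by (simp add: matrix_vector_mult_add_rdistrib matrix_vector_mul_assoc[symmetric]
          matrix_vector_mult_uminus)
    then show ?thesis
      by (simp add: swap.sylv_inv linear)
  qed
  show ?thesis
    unfolding matG_def
    by (rule has_field_derivative_resolvent[OF
          has_field_derivative_system[OF matA_derivs(1) matAbar_derivs(1)] dX dR rank1 open_slices(1)])
      (use z in \<open>simp_all add: in_Omega\<close>)
qed

text \<open>Here the derivative is \<open>A (Ab Lb - L Ab)\<close>, which the barred Sylvester
  relation itself reduces to \<open>- (A \<alpha>b) ab\<close>.\<close>

lemma eta_flow:
  assumes z: "(\<xi>, \<eta>) \<in> \<Omega>"
    and dX: "\<And>i. ((\<lambda>y. X (\<xi>, y) $ i) has_field_derivative X' $ i) (at \<eta>)"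
    and dR: "\<And>i. ((\<lambda>y. R (\<xi>, y) $ i) has_field_derivative R' $ i) (at \<eta>)"
  shows "((\<lambda>y. R (\<xi>, y) \<odot> (G (\<xi>, y) *v X (\<xi>, y))) has_field_derivative
    R' \<odot> (G (\<xi>, \<eta>) *v X (\<xi>, \<eta>))
    + (ab (\<xi>, \<eta>) \<odot> (G (\<xi>, \<eta>) *v X (\<xi>, \<eta>)))
        * (R (\<xi>, \<eta>) \<odot> (G (\<xi>, \<eta>) *v (A (\<xi>, \<eta>) *v \<alpha>b)))
    + R (\<xi>, \<eta>) \<odot> (G (\<xi>, \<eta>) *v X')) (at \<eta>)"
proof -
  interpret sylvester_pair "diag L" "matrix_inv (diag L)" "diag Lb" "matrix_inv (diag Lb)"
    "A (\<xi>, \<eta>)" "Ab (\<xi>, \<eta>)" "G (\<xi>, \<eta>)" "Gb (\<xi>, \<eta>)" "a (\<xi>, \<eta>)" "ab (\<xi>, \<eta>)"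
    "b (\<xi>, \<eta>)" "bb (\<xi>, \<eta>)" \<alpha> \<alpha>b \<beta> \<beta>b
    by (rule sylvester[OF z])
  have rank1: "(- (A (\<xi>, \<eta>) ** diag L) ** Ab (\<xi>, \<eta>)
      + A (\<xi>, \<eta>) ** (Ab (\<xi>, \<eta>) ** diag Lb)) *v y
      = - (ab (\<xi>, \<eta>) \<odot> y) *s (A (\<xi>, \<eta>) *v \<alpha>b)" for y
  proof -
    have "(- (A (\<xi>, \<eta>) ** diag L) ** Ab (\<xi>, \<eta>)
      + A (\<xi>, \<eta>) ** (Ab (\<xi>, \<eta>) ** diag Lb)) *v y
      = A (\<xi>, \<eta>) *v (Ab (\<xi>, \<eta>) *v (diag Lb *v y))
       - A (\<xi>, \<eta>) *v (diag L *v (Ab (\<xi>, \<eta>) *v y))"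
      by (simp add: matrix_vector_mult_add_rdistrib matrix_vector_mul_assoc[symmetric]
          matrix_vector_mult_uminus)
    then show ?thesis
      by (simp add: sylvb linear)
  qed
  show ?thesis
    unfolding matG_def
    by (rule has_field_derivative_resolvent[OF
          has_field_derivative_system[OF matA_derivs(2) matAbar_derivs(2)] dX dR rank1 open_slices(2)])
      (use z in \<open>simp_all add: in_Omega\<close>)
qed


lemma column_derivs:
  "((\<lambda>x. (A (x, \<eta>) *v u) $ i) has_field_derivative (A (\<xi>, \<eta>) *v (matrix_inv (diag L) *v u)) $ i) (at \<xi>)"
  "((\<lambda>y. (A (\<xi>, y) *v u) $ i) has_field_derivative (- (A (\<xi>, \<eta>) *v (diag L *v u))) $ i) (at \<eta>)"
proof -
  have "((\<lambda>x. \<Sum>k\<in>UNIV. A (x, \<eta>) $ i $ k * u $ k) has_field_derivative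
      (\<Sum>k\<in>UNIV. (A (\<xi>, \<eta>) ** matrix_inv (diag L)) $ i $ k * u $ k)) (at \<xi>)"
    by (intro DERIV_sum DERIV_cmult_right matA_derivs)
  then show "((\<lambda>x. (A (x, \<eta>) *v u) $ i) has_field_derivative
      (A (\<xi>, \<eta>) *v (matrix_inv (diag L) *v u)) $ i) (at \<xi>)"
    unfolding matrix_vector_mul_assoc by (simp add: matrix_vector_mult_def)
  have "((\<lambda>y. \<Sum>k\<in>UNIV. A (\<xi>, y) $ i $ k * u $ k) has_field_derivative
      (\<Sum>k\<in>UNIV. (- (A (\<xi>, \<eta>) ** diag L)) $ i $ k * u $ k)) (at \<eta>)"
    by (intro DERIV_sum DERIV_cmult_right matA_derivs)
  then show "((\<lambda>y. (A (\<xi>, y) *v u) $ i) has_field_derivative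
      (- (A (\<xi>, \<eta>) *v (diag L *v u))) $ i) (at \<eta>)"
    unfolding matrix_vector_mul_assoc matrix_vector_mult_uminus(1)[symmetric]
    by (simp add: matrix_vector_mult_def)
qed

lemma row_xi_derivs:
  "((\<lambda>x. ab (x, \<eta>) $ i) has_field_derivative (- bb (\<xi>, \<eta>)) $ i) (at \<xi>)"
  "((\<lambda>x. bb (x, \<eta>) $ i) has_field_derivative (- (bb (\<xi>, \<eta>) v* matrix_inv (diag Lb))) $ i) (at \<xi>)"
  using row_abar_derivs(1)[OF Lb_nz, of cb \<eta> i \<xi>]
    DERIV_cdivide[OF row_abar_derivs(1)[OF Lb_nz, of cb \<eta> i \<xi>], of "Lb $ i"]
  by (simp_all add: row_bbar_def matrix_inv_diag Lb_nz vector_diag divide_inverse)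

lemma row_eta_derivs:
  "((\<lambda>y. ab (\<xi>, y) $ i) has_field_derivative (ab (\<xi>, \<eta>) v* diag Lb) $ i) (at \<eta>)"
  "((\<lambda>y. bb (\<xi>, y) $ i) has_field_derivative ab (\<xi>, \<eta>) $ i) (at \<eta>)"
  using row_abar_derivs(2)[OF Lb_nz, of cb \<xi> i \<eta>]
    DERIV_cdivide[OF row_abar_derivs(2)[OF Lb_nz, of cb \<xi> i \<eta>], of "Lb $ i"]
  by (simp_all add: row_bbar_def matrix_inv_diag Lb_nz vector_diag divide_inverse[symmetric])

text \<open>Puts the derivative of a constant column into the form expected by
  \<open>xi_flow\<close> and \<open>eta_flow\<close>.\<close>

lemma zero_column_deriv: "((\<lambda>t. u $ i) has_field_derivative (0 :: complex ^ 'n) $ i) (at t)"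
  by simp

text \<open>For \<open>w1\<close> and \<open>q\<close> the column is constant and the row
  \<open>ab\<close> has derivative \<open>- bb\<close>, so the row term and the rank-one term
  combine to a multiple of \<open>s\<close>.\<close>

lemma xi_derivs:
  assumes z: "(\<xi>, \<eta>) \<in> \<Omega>"
  shows "((\<lambda>x. w1 L Lb \<alpha> \<alpha>b c cb (x, \<eta>)) has_field_derivative
      - (pb (\<xi>, \<eta>) * s (\<xi>, \<eta>))) (at \<xi>)"
    and "((\<lambda>x. q (x, \<eta>)) has_field_derivative - (w3 L Lb \<alpha> \<alpha>b c cb (\<xi>, \<eta>) * s (\<xi>, \<eta>))) (at \<xi>)"
    and "((\<lambda>x. r (x, \<eta>)) has_field_derivative w3 L Lb \<alpha> \<alpha>b c cb (\<xi>, \<eta>) * p (\<xi>, \<eta>)) (at \<xi>)"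
proof -
  interpret sylvester_pair "diag L" "matrix_inv (diag L)" "diag Lb" "matrix_inv (diag Lb)"
    "A (\<xi>, \<eta>)" "Ab (\<xi>, \<eta>)" "G (\<xi>, \<eta>)" "Gb (\<xi>, \<eta>)" "a (\<xi>, \<eta>)" "ab (\<xi>, \<eta>)"
    "b (\<xi>, \<eta>)" "bb (\<xi>, \<eta>)" \<alpha> \<alpha>b \<beta> \<beta>b
    by (rule sylvester[OF z])
  show "((\<lambda>x. w1 L Lb \<alpha> \<alpha>b c cb (x, \<eta>)) has_field_derivative
      - (pb (\<xi>, \<eta>) * s (\<xi>, \<eta>))) (at \<xi>)"
    unfolding w1_def
    by (rule DERIV_cong, rule xi_flow[OF z zero_column_deriv row_xi_derivs(1)])
       (simp add: pb_def s_def scalar_product_uminus_left scalar_product_linear algebra_simps)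
  show "((\<lambda>x. q (x, \<eta>)) has_field_derivative - (w3 L Lb \<alpha> \<alpha>b c cb (\<xi>, \<eta>) * s (\<xi>, \<eta>))) (at \<xi>)"
    unfolding q_def w3_def
    by (rule DERIV_cong, rule xi_flow[OF z zero_column_deriv row_xi_derivs(1)])
       (simp add: s_def scalar_product_uminus_left scalar_product_linear algebra_simps)
  \<comment> \<open>Row and column both vary. Expanding the row term by \<open>bb_Lb'\<close>
    cancels the other two terms and leaves only \<open>w3 * p\<close>.\<close>
  have "((\<lambda>x. bb (x, \<eta>) \<odot> (G (x, \<eta>) *v (A (x, \<eta>) *v \<alpha>b))) has_field_derivative
      w3 L Lb \<alpha> \<alpha>b c cb (\<xi>, \<eta>) * p (\<xi>, \<eta>)) (at \<xi>)"
    by (rule DERIV_cong, rule xi_flow[OF z column_derivs(1) row_xi_derivs(2)])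
       (simp add: p_def w3_def scalar_product_uminus_left scalar_product_vector_matrix bb_Lb'
         \<beta>b[symmetric] algebra_simps)
  then show "((\<lambda>x. r (x, \<eta>)) has_field_derivative w3 L Lb \<alpha> \<alpha>b c cb (\<xi>, \<eta>) * p (\<xi>, \<eta>)) (at \<xi>)"
    unfolding r_def by (auto intro!: derivative_eq_intros)
qed

lemma eta_derivs:
  assumes z: "(\<xi>, \<eta>) \<in> \<Omega>"
  shows "((\<lambda>y. w3 L Lb \<alpha> \<alpha>b c cb (\<xi>, y)) has_field_derivative q (\<xi>, \<eta>) * r (\<xi>, \<eta>)) (at \<eta>)"
    and "((\<lambda>y. pb (\<xi>, y)) has_field_derivative w1 L Lb \<alpha> \<alpha>b c cb (\<xi>, \<eta>) * r (\<xi>, \<eta>)) (at \<eta>)"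
    and "((\<lambda>y. s (\<xi>, y)) has_field_derivative - (w1 L Lb \<alpha> \<alpha>b c cb (\<xi>, \<eta>) * qb (\<xi>, \<eta>))) (at \<eta>)"
proof -
  interpret sylvester_pair "diag L" "matrix_inv (diag L)" "diag Lb" "matrix_inv (diag Lb)"
    "A (\<xi>, \<eta>)" "Ab (\<xi>, \<eta>)" "G (\<xi>, \<eta>)" "Gb (\<xi>, \<eta>)" "a (\<xi>, \<eta>)" "ab (\<xi>, \<eta>)"
    "b (\<xi>, \<eta>)" "bb (\<xi>, \<eta>)" \<alpha> \<alpha>b \<beta> \<beta>b
    by (rule sylvester[OF z])
  show "((\<lambda>y. w3 L Lb \<alpha> \<alpha>b c cb (\<xi>, y)) has_field_derivative q (\<xi>, \<eta>) * r (\<xi>, \<eta>)) (at \<eta>)"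
    unfolding w3_def
    by (rule DERIV_cong, rule eta_flow[OF z zero_column_deriv row_eta_derivs(2)])
       (simp add: q_def r_def scalar_product_linear algebra_simps)
  show "((\<lambda>y. pb (\<xi>, y)) has_field_derivative w1 L Lb \<alpha> \<alpha>b c cb (\<xi>, \<eta>) * r (\<xi>, \<eta>)) (at \<eta>)"
    unfolding pb_def w1_def
    by (rule DERIV_cong, rule eta_flow[OF z zero_column_deriv row_eta_derivs(2)])
       (simp add: r_def scalar_product_linear algebra_simps)
  \<comment> \<open>Identifies the derivative of the column \<open>A \<beta>b\<close> as
    \<open>- A \<alpha>b\<close>; after \<open>ab_Lb\<close> everything but \<open>w1 * qb\<close>
    cancels.\<close>
  have "diag L *v \<beta>b = \<alpha>b"
    by (simp add: \<beta>b LL')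
  then have "((\<lambda>y. ab (\<xi>, y) \<odot> (G (\<xi>, y) *v (A (\<xi>, y) *v \<beta>b))) has_field_derivative
      w1 L Lb \<alpha> \<alpha>b c cb (\<xi>, \<eta>) * qb (\<xi>, \<eta>)) (at \<eta>)"
    by (intro DERIV_cong[OF eta_flow[OF z column_derivs(2) row_eta_derivs(1)]])
       (simp add: qb_def w1_def scalar_product_vector_matrix ab_Lb
         matrix_vector_mult_uminus scalar_product_linear algebra_simps)
  then show "((\<lambda>y. s (\<xi>, y)) has_field_derivative - (w1 L Lb \<alpha> \<alpha>b c cb (\<xi>, \<eta>) * qb (\<xi>, \<eta>))) (at \<eta>)"
    unfolding s_def by (auto intro!: derivative_eq_intros)
qed

text \<open>The branch of the square root, given without extracting a root. By
  \<open>relations\<close> it also equals \<open>2 r s - 1\<close> and \<open>r s - pb qb\<close> on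
  \<Omega>.\<close>

definition "f z = r z * s z - p z * q z"

lemma mixed_derivs:
  assumes z: "(\<xi>, \<eta>) \<in> \<Omega>"
  shows "((\<lambda>y. pb (\<xi>, y) * s (\<xi>, y)) has_field_derivative
      w1 L Lb \<alpha> \<alpha>b c cb (\<xi>, \<eta>) * f (\<xi>, \<eta>)) (at \<eta>)"
    and "((\<lambda>x. q (x, \<eta>) * r (x, \<eta>)) has_field_derivative
      - (w3 L Lb \<alpha> \<alpha>b c cb (\<xi>, \<eta>) * f (\<xi>, \<eta>))) (at \<xi>)"
proof -
  \<comment> \<open>\<open>p q\<close> and \<open>pb qb\<close> agree, both being
    \<open>1 - r s\<close>. The first product rule produces \<open>pb qb\<close>, the second one
    \<open>p q\<close>.\<close>
  have f: "f (\<xi>, \<eta>) = r (\<xi>, \<eta>) * s (\<xi>, \<eta>) - pb (\<xi>, \<eta>) * qb (\<xi>, \<eta>)"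
    using relations(1,2)[OF z] unfolding f_def by algebra
  show "((\<lambda>y. pb (\<xi>, y) * s (\<xi>, y)) has_field_derivative
      w1 L Lb \<alpha> \<alpha>b c cb (\<xi>, \<eta>) * f (\<xi>, \<eta>)) (at \<eta>)"
    by (rule DERIV_cong, rule DERIV_mult[OF eta_derivs(2,3)[OF z]]) (simp add: f algebra_simps)
  show "((\<lambda>x. q (x, \<eta>) * r (x, \<eta>)) has_field_derivative
      - (w3 L Lb \<alpha> \<alpha>b c cb (\<xi>, \<eta>) * f (\<xi>, \<eta>))) (at \<xi>)"
    by (rule DERIV_cong, rule DERIV_mult[OF xi_derivs(2,3)[OF z]]) (simp add: f_def algebra_simps)
qed

end

section \<open>Transfer to \<open>w2\<close> and \<open>w4\<close> by symmetry\<close>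

context dirac_data
begin

text \<open>The left side is \<open>rb sb - pb qb\<close>. The relations and their barred versions
  give \<open>rb sb = 1 - p q = r s\<close> and \<open>pb qb = p q\<close>.\<close>

lemma swap_f:
  assumes "z \<in> \<Omega>"
  shows "swap.f (- z) = f z"
  using relations[OF assms] swap.relations[OF uminus_in_Omega[OF assms]]
  unfolding swap_neg f_def swap.f_def by algebra

text \<open>The derivatives of \<open>w1\<close> and \<open>w3\<close> for the swapped data; the
  reflection contributes one sign.\<close>

lemma first_derivs_swap:
  assumes z: "(\<xi>, \<eta>) \<in> \<Omega>"
  shows "((\<lambda>x. w2 L Lb \<alpha> \<alpha>b c cb (x, \<eta>)) has_field_derivative p (\<xi>, \<eta>) * sb (\<xi>, \<eta>)) (at \<xi>)"
    and "((\<lambda>y. w4 L Lb \<alpha> \<alpha>b c cb (\<xi>, y)) has_field_derivative - (qb (\<xi>, \<eta>) * rb (\<xi>, \<eta>))) (at \<eta>)"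
  using has_field_derivative_mirror[OF swap.xi_derivs(1)[of "- \<xi>" "- \<eta>"]]
    has_field_derivative_mirror[OF swap.eta_derivs(1)[of "- \<xi>" "- \<eta>"]] uminus_in_Omega[OF z]
    w_swap[of "(_, _)"] swap_neg[of "(_, _)"]
  by simp_all

lemma mixed_derivs_swap:
  assumes z: "(\<xi>, \<eta>) \<in> \<Omega>"
  shows "((\<lambda>y. p (\<xi>, y) * sb (\<xi>, y)) has_field_derivative
      - (w2 L Lb \<alpha> \<alpha>b c cb (\<xi>, \<eta>) * f (\<xi>, \<eta>))) (at \<eta>)"
    and "((\<lambda>x. qb (x, \<eta>) * rb (x, \<eta>)) has_field_derivative
      w4 L Lb \<alpha> \<alpha>b c cb (\<xi>, \<eta>) * f (\<xi>, \<eta>)) (at \<xi>)"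
  using has_field_derivative_mirror[OF swap.mixed_derivs(1)[of "- \<xi>" "- \<eta>"]]
    has_field_derivative_mirror[OF swap.mixed_derivs(2)[of "- \<xi>" "- \<eta>"]] uminus_in_Omega[OF z]
    w_swap[of "(_, _)"] swap_neg[of "(_, _)"] swap_f[OF z]
  by simp_all

section \<open>Assembly of the Dirac equation\<close>

abbreviation "\<phi> \<equiv> phi_vec L Lb \<alpha> \<alpha>b c cb"

lemma phi_nth:
  "\<phi> z $ 1 = w4 L Lb \<alpha> \<alpha>b c cb z" "\<phi> z $ 2 = w1 L Lb \<alpha> \<alpha>b c cb z"
  "\<phi> z $ 3 = w3 L Lb \<alpha> \<alpha>b c cb z" "\<phi> z $ 4 = w2 L Lb \<alpha> \<alpha>b c cb z"
  by (simp_all add: phi_vec_def)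

lemma Dirac_phi:
  assumes "z \<in> \<Omega>"
  shows "Dirac \<phi> z = vector [p z * sb z, q z * r z, pb z * s z, qb z * rb z]"
  using assms
  by (cases z) (simp add: Dirac_def phi_nth d_xi_def d_eta_def
      DERIV_imp_deriv[OF xi_derivs(1)] DERIV_imp_deriv[OF eta_derivs(1)]
      DERIV_imp_deriv[OF first_derivs_swap(1)] DERIV_imp_deriv[OF first_derivs_swap(2)])

lemma differentiable_phi: "Dirac_differentiable_on \<Omega> \<phi>"
  unfolding Dirac_differentiable_on_def phi_nth field_differentiable_def
  using xi_derivs(1) eta_derivs(1) first_derivs_swap by blast

text \<open>The closed form of \<open>Dirac \<phi>\<close> is known only on \<Omega>, so the mixed
  derivatives are transferred along its open slices.\<close>

lemma Dirac_phi_derivs: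
  assumes z: "(\<xi>, \<eta>) \<in> \<Omega>"
  shows "((\<lambda>x. Dirac \<phi> (x, \<eta>) $ 4) has_field_derivative
      w4 L Lb \<alpha> \<alpha>b c cb (\<xi>, \<eta>) * f (\<xi>, \<eta>)) (at \<xi>)"
    and "((\<lambda>y. Dirac \<phi> (\<xi>, y) $ 3) has_field_derivative
      w1 L Lb \<alpha> \<alpha>b c cb (\<xi>, \<eta>) * f (\<xi>, \<eta>)) (at \<eta>)"
    and "((\<lambda>x. Dirac \<phi> (x, \<eta>) $ 2) has_field_derivative
      - (w3 L Lb \<alpha> \<alpha>b c cb (\<xi>, \<eta>) * f (\<xi>, \<eta>))) (at \<xi>)"
    and "((\<lambda>y. Dirac \<phi> (\<xi>, y) $ 1) has_field_derivative
      - (w2 L Lb \<alpha> \<alpha>b c cb (\<xi>, \<eta>) * f (\<xi>, \<eta>))) (at \<eta>)"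
proof -
  have xi: "((\<lambda>x. Dirac \<phi> (x, \<eta>) $ k) has_field_derivative d) (at \<xi>)"
    if "((\<lambda>x. g (x, \<eta>)) has_field_derivative d) (at \<xi>)" "\<And>z. z \<in> \<Omega> \<Longrightarrow> g z = Dirac \<phi> z $ k" for g k d
    by (rule has_field_derivative_transform_within_open[OF that(1) open_slices(1)[of \<eta>]])
      (simp_all add: z that(2))
  have eta: "((\<lambda>y. Dirac \<phi> (\<xi>, y) $ k) has_field_derivative d) (at \<eta>)"
    if "((\<lambda>y. g (\<xi>, y)) has_field_derivative d) (at \<eta>)" "\<And>z. z \<in> \<Omega> \<Longrightarrow> g z = Dirac \<phi> z $ k" for g k d
    by (rule has_field_derivative_transform_within_open[OF that(1) open_slices(2)[of \<xi>]])
      (simp_all add: z that(2))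
  show "((\<lambda>x. Dirac \<phi> (x, \<eta>) $ 4) has_field_derivative
      w4 L Lb \<alpha> \<alpha>b c cb (\<xi>, \<eta>) * f (\<xi>, \<eta>)) (at \<xi>)"
    by (rule xi[OF mixed_derivs_swap(2)[OF z]]) (simp add: Dirac_phi)
  show "((\<lambda>y. Dirac \<phi> (\<xi>, y) $ 3) has_field_derivative
      w1 L Lb \<alpha> \<alpha>b c cb (\<xi>, \<eta>) * f (\<xi>, \<eta>)) (at \<eta>)"
    by (rule eta[OF mixed_derivs(1)[OF z]]) (simp add: Dirac_phi)
  show "((\<lambda>x. Dirac \<phi> (x, \<eta>) $ 2) has_field_derivative
      - (w3 L Lb \<alpha> \<alpha>b c cb (\<xi>, \<eta>) * f (\<xi>, \<eta>))) (at \<xi>)"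
    by (rule xi[OF mixed_derivs(2)[OF z]]) (simp add: Dirac_phi)
  show "((\<lambda>y. Dirac \<phi> (\<xi>, y) $ 1) has_field_derivative
      - (w2 L Lb \<alpha> \<alpha>b c cb (\<xi>, \<eta>) * f (\<xi>, \<eta>))) (at \<eta>)"
    by (rule eta[OF mixed_derivs_swap(1)[OF z]]) (simp add: Dirac_phi)
qed

lemma differentiable_Dirac_phi: "Dirac_differentiable_on \<Omega> (Dirac \<phi>)"
  unfolding Dirac_differentiable_on_def field_differentiable_def
  using Dirac_phi_derivs by blast

lemma Dirac_Dirac_phi:
  assumes "z \<in> \<Omega>"
  shows "Dirac (Dirac \<phi>) z = f z *s \<phi> z"
proof (cases z)
  case (Pair \<xi> \<eta>)
  with assms have z: "(\<xi>, \<eta>) \<in> \<Omega>" by simp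
  show ?thesis
    unfolding Pair Dirac_def[of "Dirac \<phi>"]
    by (simp add: vec_eq_iff forall_4 phi_nth d_xi_def d_eta_def mult.commute
        Dirac_phi_derivs[OF z, THEN DERIV_imp_deriv])
qed

lemma f_squared:
  assumes "z \<in> \<Omega>"
  shows "(f z)\<^sup>2 = 1 - scalar_product (Dirac \<phi> z) (gamma5 *v Dirac \<phi> z)"
proof -
  have "scalar_product (Dirac \<phi> z) (gamma5 *v Dirac \<phi> z)
      = 2 * ((p z * sb z) * (pb z * s z) + (q z * r z) * (qb z * rb z))"
    by (simp add: Dirac_phi[OF assms] scalar_product_def gamma5_def matrix_vector_mult_def sum_4
        algebra_simps)
  \<comment> \<open>By \<open>sb p = qb r\<close> and \<open>s pb = q rb\<close> both summands equal
    \<open>pb qb r s = p q r s\<close>, while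
    \<open>1 - f^2 = (r s + p q)^2 - (r s - p q)^2 = 4 p q r s\<close>.\<close>
  also have "\<dots> = 1 - (f z)\<^sup>2"
    using relations[OF assms] swap.relations(3)[OF uminus_in_Omega[OF assms]]
    unfolding swap_neg f_def by algebra
  finally show ?thesis by simp
qed

lemma continuous_on_f: "continuous_on \<Omega> f"
proof -
  have G: "continuous_on \<Omega> (\<lambda>z. (G z *v (A z *v u)) $ k)" for u k
    unfolding matG_def
  proof (rule continuous_on_matrix_inv_vector[OF continuous_on_system])
    show "continuous_on \<Omega> (\<lambda>z. (A z *v u) $ i)" for i
      unfolding matrix_vector_mult_def vec_lambda_beta
      by (intro continuous_intros continuous_on_matA)
  qed (simp add: in_Omega)
  have bb: "continuous_on \<Omega> (\<lambda>z. bb z $ k)" for k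
    unfolding row_bbar_def matrix_inv_diag[OF Lb_nz] vector_diag
    by (intro continuous_intros continuous_on_row_abar)
  \<comment> \<open>On \<Omega> this expression equals \<open>f\<close> and involves only
    \<open>G\<close>, so continuity of \<open>Gb\<close> does not enter.\<close>
  have "continuous_on \<Omega> (\<lambda>z. 2 * (r z * s z) - 1)"
    unfolding r_def s_def scalar_product_def
    by (intro continuous_intros G bb continuous_on_row_abar)
  then show ?thesis
  proof (rule continuous_on_eq)
    show "2 * (r z * s z) - 1 = f z" if "z \<in> \<Omega>" for z
      using relations(2)[OF that] unfolding f_def by algebra
  qed
qed

end

theorem proposition3p2:
  fixes L Lb \<alpha> \<alpha>b c cb :: "complex ^ 'n"
    and \<Omega> :: "(complex \<times> complex) set"
    and \<phi> :: "complex \<times> complex \<Rightarrow> complex ^ 4"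
  assumes L_nonzero: "\<And>j. L $ j \<noteq> 0"
    and Lb_nonzero: "\<And>j. Lb $ j \<noteq> 0"
    and L_neq_Lb: "\<And>j k. L $ j \<noteq> Lb $ k"
  defines "\<Omega> \<equiv> Omega L Lb \<alpha> \<alpha>b c cb"
    and "\<phi> \<equiv> phi_vec L Lb \<alpha> \<alpha>b c cb"
  shows "Dirac_differentiable_on \<Omega> \<phi> \<and> Dirac_differentiable_on \<Omega> (Dirac \<phi>) \<and>
    (\<exists>f :: complex \<times> complex \<Rightarrow> complex.
      continuous_on \<Omega> f \<and>
      (\<forall>p \<in> \<Omega>. (f p)\<^sup>2 = 1 - scalar_product (Dirac \<phi> p) (gamma5 *v Dirac \<phi> p) \<and>
               Dirac (Dirac \<phi>) p = f p *s \<phi> p))"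
proof -
  interpret dirac_data L Lb \<alpha> \<alpha>b c cb
    by unfold_locales (fact assms)+
  show ?thesis
    unfolding \<Omega>_def \<phi>_def
    using differentiable_phi differentiable_Dirac_phi continuous_on_f f_squared Dirac_Dirac_phi
    by blast
qed

end
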